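(* Let $\mathfrak{g}$ be a nilpotent Lie algebra over a finite field $\mathbb{F}$, and let $n,k$ be integers with $n\le k+1$. Suppose that (1) the set $\{x\in\mathfrak{g}: b(x)\ge n\}$ is contained in the union of $|\mathbb{F}|$ proper Lie subalgebras of $\mathfrak{g}$; and (2) the set $\{x\in\mathfrak{g}: b(x)\le k\}$ generates $\mathfrak{g}$ as a Lie algebra. Then $\dim[\mathfrak{g},\mathfrak{g}]\le \frac{(n-1)(n-2)}{2}+k$.
   Context: For an element $x$ of a Lie algebra $\mathfrak{g}$ over a field, the centralizer is $C_{\mathfrak{g}}(x)=\{y\in\mathfrak{g} : [x,y]=0\}$, and the breadth of $x$ is $b(x)=\dim\mathfrak{g}-\dim C_{\mathfrak{g}}(x)$, i.e. the codimension of $C_{\mathfrak{g}}(x)$ in $\mathfrak{g}$ (a non-negative integer or $\infty$). $[\mathfrak{g},\mathfrak{g}]$ denotes the derived subalgebra. *)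

theory Defs
  imports Main "HOL-Library.Extended_Nat"
begin

definition lie_algebra :: "('k::field \<Rightarrow> 'g::ab_group_add \<Rightarrow> 'g) \<Rightarrow> ('g \<Rightarrow> 'g \<Rightarrow> 'g) \<Rightarrow> bool" where
  "lie_algebra scale br \<longleftrightarrow>
     vector_space scale \<and>
     (\<forall>x y z. br (x + y) z = br x z + br y z) \<and>
     (\<forall>x y z. br x (y + z) = br x y + br x z) \<and>
     (\<forall>a x y. br (scale a x) y = scale a (br x y)) \<and>
     (\<forall>a x y. br x (scale a y) = scale a (br x y)) \<and>
     (\<forall>x. br x x = 0) \<and>
     (\<forall>x y z. br x (br y z) + br y (br z x) + br z (br x y) = 0)"

definition lie_subalgebra :: "('k::field \<Rightarrow> 'g::ab_group_add \<Rightarrow> 'g) \<Rightarrow> ('g \<Rightarrow> 'g \<Rightarrow> 'g) \<Rightarrow> 'g set \<Rightarrow> bool" where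
  "lie_subalgebra scale br H \<longleftrightarrow>
     module.subspace scale H \<and> (\<forall>x\<in>H. \<forall>y\<in>H. br x y \<in> H)"

definition lie_generated :: "('k::field \<Rightarrow> 'g::ab_group_add \<Rightarrow> 'g) \<Rightarrow> ('g \<Rightarrow> 'g \<Rightarrow> 'g) \<Rightarrow> 'g set \<Rightarrow> 'g set" where
  "lie_generated scale br S = \<Inter>{H. lie_subalgebra scale br H \<and> S \<subseteq> H}"

fun lower_central :: "('k::field \<Rightarrow> 'g::ab_group_add \<Rightarrow> 'g) \<Rightarrow> ('g \<Rightarrow> 'g \<Rightarrow> 'g) \<Rightarrow> nat \<Rightarrow> 'g set" where
  "lower_central scale br 0 = UNIV"
| "lower_central scale br (Suc i) =
     module.span scale {br x y | x y. y \<in> lower_central scale br i}"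

definition nilpotent_lie :: "('k::field \<Rightarrow> 'g::ab_group_add \<Rightarrow> 'g) \<Rightarrow> ('g \<Rightarrow> 'g \<Rightarrow> 'g) \<Rightarrow> bool" where
  "nilpotent_lie scale br \<longleftrightarrow> (\<exists>m. lower_central scale br m = {0})"

definition derived :: "('k::field \<Rightarrow> 'g::ab_group_add \<Rightarrow> 'g) \<Rightarrow> ('g \<Rightarrow> 'g \<Rightarrow> 'g) \<Rightarrow> 'g set" where
  "derived scale br = module.span scale {br x y | x y. True}"

definition edim :: "('k::field \<Rightarrow> 'g::ab_group_add \<Rightarrow> 'g) \<Rightarrow> 'g set \<Rightarrow> enat" where
  "edim scale U =
     (if \<exists>S. finite S \<and> S \<subseteq> U \<and> module.span scale S = U
      then enat (LEAST d. \<exists>S. finite S \<and> S \<subseteq> U \<and> module.span scale S = U \<and> card S = d)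
      else \<infinity>)"

definition ecodim :: "('k::field \<Rightarrow> 'g::ab_group_add \<Rightarrow> 'g) \<Rightarrow> 'g set \<Rightarrow> enat" where
  "ecodim scale C =
     (if \<exists>S. finite S \<and> module.span scale (C \<union> S) = UNIV
      then enat (LEAST d. \<exists>S. finite S \<and> module.span scale (C \<union> S) = UNIV \<and> card S = d)
      else \<infinity>)"

definition centralizer :: "('g \<Rightarrow> 'g \<Rightarrow> 'g::ab_group_add) \<Rightarrow> 'g \<Rightarrow> 'g set" where
  "centralizer br x = {y. br x y = 0}"

definition breadth :: "('k::field \<Rightarrow> 'g::ab_group_add \<Rightarrow> 'g) \<Rightarrow> ('g \<Rightarrow> 'g \<Rightarrow> 'g) \<Rightarrow> 'g \<Rightarrow> enat" where
  "breadth scale br x = ecodim scale (centralizer br x)"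

end

theory Submission
  imports Defs
begin

text \<open>
  Only the alternating bilinear map underlying the bracket matters. By nilpotency the proper
  subalgebras \<open>H\<^sub>i\<close> may be enlarged to hyperplanes containing the derived algebra, and a set that
  generates the Lie algebra then has an element outside every proper subspace containing the
  derived algebra.

  The engine is the choice of a pivot \<open>t\<close> of breadth at most \<open>m\<close>, followed by factoring \<open>[t, V]\<close>
  out of the target space: this costs \<open>m\<close> dimensions, and the breadth of every \<open>x\<close> with
  \<open>[t, x] \<noteq> 0\<close> drops by one. Since \<open>[t, x + a t] = [t, x]\<close>, it suffices that some \<open>x + a t\<close> has
  small breadth. Hence after one step the elements of large breadth lie in the centralizer of \<open>t\<close>,
  a single proper subspace, and the argument can be iterated.

  For the first pivot put \<open>L = H\<^sub>0 \<inter> H\<^sub>1\<close> and \<open>J = L + \<langle>t\<rangle>\<close> with \<open>t\<close> outside all \<open>H\<^sub>i\<close>. For \<open>x \<in> J\<close>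
  the hyperplanes \<open>H\<^sub>0\<close> and \<open>H\<^sub>1\<close> exclude the same single value of \<open>a\<close>, so the \<open>q\<close> hyperplanes
  exclude at most \<open>q - 1\<close> of the \<open>q\<close> elements \<open>x + a t\<close>.
\<close>

section \<open>Counting: excluded scalars and triangular numbers\<close>

lemma pigeonhole_avoid:
  fixes P :: "'i \<Rightarrow> 'k \<Rightarrow> bool"
  assumes "finite I" "card I < card (UNIV :: 'k set)"
    and uniq: "\<And>i a b. i \<in> I \<Longrightarrow> P i a \<Longrightarrow> P i b \<Longrightarrow> a = b"
  shows "\<exists>a. \<forall>i\<in>I. \<not> P i a"
proof (rule ccontr)
  assume "\<not> ?thesis"
  then obtain f where f: "\<And>a. f a \<in> I \<and> P (f a) a"
    by metis
  have "inj f"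
    by (metis f injI uniq)
  then have "card (UNIV :: 'k set) \<le> card I"
    using f \<open>finite I\<close> by (intro card_inj_on_le) auto
  then show False
    using assms(2) by simp
qed

text \<open>The binomial coefficient \<open>m\<close> choose 2. It arises as the total cost of a
  chain of pivots whose breadths drop by one each time: \<open>tri (Suc m)\<close> is m + (m-1) +
  ... + 1.\<close>

definition tri :: "nat \<Rightarrow> nat" where
  "tri m = \<Sum>{..<m}"

lemma tri_Suc [simp]: "tri (Suc m) = tri m + m"
  by (simp add: tri_def)

lemma tri_0 [simp]: "tri 0 = 0"
  by (simp add: tri_def)

lemma tri_eq: "int (tri m) = (int m * (int m - 1)) div 2"
proof (induction m)
  case (Suc m)
  have "int (Suc m) * (int (Suc m) - 1) = int m * (int m - 1) + int m * 2"
    by (simp add: algebra_simps)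
  then show ?case
    using Suc by simp
qed simp

section \<open>Linear algebra: lines, hyperplanes and unions of subspaces\<close>

context vector_space
begin

lemma subspace_diff_scale: "subspace S \<Longrightarrow> x \<in> S \<Longrightarrow> y \<in> S \<Longrightarrow> x - c *s y \<in> S"
  by (simp add: subspace_diff subspace_scale)

lemma line_meets_complement_uniquely:
  assumes "subspace H" "t \<notin> H" "x + a *s t \<in> H" "x + b *s t \<in> H"
  shows "a = b"
proof (rule ccontr)
  assume "a \<noteq> b"
  have "(x + a *s t) - (x + b *s t) \<in> H"
    using assms subspace_diff by blast
  then have "(a - b) *s t \<in> H"
    by (simp add: algebra_simps scale_left_diff_distrib)
  then have "inverse (a - b) *s (a - b) *s t \<in> H"
    using assms(1) subspace_scale by blast
  then show False
    using \<open>a \<noteq> b\<close> assms(2) by simp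
qed

lemma line_through_outside_uniquely:
  assumes "subspace H" "t \<notin> H" "t + a *s l \<in> H" "t + b *s l \<in> H"
  shows "a = b"
proof (cases "l \<in> H")
  case True
  then have "(t + a *s l) - a *s l \<in> H"
    using assms subspace_diff subspace_scale by blast
  then show ?thesis
    using assms(2) by simp
next
  case False
  then show ?thesis
    using assms line_meets_complement_uniquely by blast
qed

lemma line_leaves_subspace:
  assumes "subspace J" "subspace L" "t \<in> J - L" "x \<in> J"
  shows "\<exists>a. x + a *s t \<in> J - L"
proof (cases "x \<in> L")
  case True
  then have "x + t \<notin> L"
    using assms subspace_diff[of L "x + t" x] by auto
  then have "x + 1 *s t \<in> J - L"
    using assms by (simp add: subspace_add)
  then show ?thesis ..
next
  case False
  then have "x + 0 *s t \<in> J - L"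
    using assms by simp
  then show ?thesis ..
qed

lemma subspace_not_union_two:
  assumes "subspace J" "subspace A" "subspace B" "\<not> J \<subseteq> A" "\<not> J \<subseteq> B"
  shows "\<exists>e\<in>J. e \<notin> A \<and> e \<notin> B"
proof -
  obtain a b where ab: "a \<in> J" "a \<notin> A" "b \<in> J" "b \<notin> B"
    using assms by blast
  have "a + b \<in> J"
    using ab assms subspace_add by blast
  moreover have "a + b \<notin> A" if "b \<in> A"
    using that ab assms subspace_diff[of A "a + b" b] by auto
  moreover have "a + b \<notin> B" if "a \<in> B"
    using that ab assms subspace_diff[of B "a + b" a] by auto
  ultimately show ?thesis
    using ab by blast
qed

text \<open>If \<open>u\<close> and \<open>v\<close> lie in a common one of the two subspaces, the
  three translates by \<open>e\<close> are forced into the other, which then contains e = (e+u) +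
  (e+v) - (e+(u+v)). Otherwise each of \<open>u\<close>, \<open>v\<close> lies in exactly one
  subspace, and \<open>u + v\<close> in neither. This works over every field, even with two
  elements.\<close>

lemma subspace_pair_avoid:
  assumes "subspace A" "subspace B" "e \<notin> A" "e \<notin> B"
  shows "\<exists>x\<in>{u, v, u + v, e + u, e + v, e + (u + v)}. x \<notin> A \<and> x \<notin> B"
proof (rule ccontr)
  assume "\<not> ?thesis"
  then have all: "u \<in> A \<or> u \<in> B" "v \<in> A \<or> v \<in> B" "u + v \<in> A \<or> u + v \<in> B"
    "e + u \<in> A \<or> e + u \<in> B" "e + v \<in> A \<or> e + v \<in> B" "e + (u + v) \<in> A \<or> e + (u + v) \<in> B"
    by auto
  have cancel: "p \<in> C" if "subspace C" "p + r \<in> C" "r \<in> C" for p r C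
    using subspace_diff[OF that] by simp
  have cancel': "p \<in> C" if "subspace C" "r + p \<in> C" "r \<in> C" for p r C
    using cancel[of C p r] that by (simp add: add.commute)
  have False if C: "subspace C" "subspace D" "e \<notin> C" "e \<notin> D" "u \<in> C" "v \<in> C"
    and D: "e + u \<in> C \<or> e + u \<in> D" "e + v \<in> C \<or> e + v \<in> D"
      "e + (u + v) \<in> C \<or> e + (u + v) \<in> D" for C D
  proof -
    have "u + v \<in> C"
      using C subspace_add by blast
    then have "e + u \<in> D" "e + v \<in> D" "e + (u + v) \<in> D"
      using C D cancel by blast+
    moreover have "e = (e + u) + (e + v) - (e + (u + v))"
      by simp
    ultimately show False
      using C(2,4) subspace_add subspace_diff by metis
  qed
  from this[of A B] this[of B A]
  have "\<not> (u \<in> A \<and> v \<in> A)" "\<not> (u \<in> B \<and> v \<in> B)"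
    using all assms by blast+
  then consider "u \<in> A" "u \<notin> B" "v \<in> B" "v \<notin> A" | "u \<in> B" "u \<notin> A" "v \<in> A" "v \<notin> B"
    using all(1,2) by blast
  then show False
    using all(3) assms(1,2) cancel[of A u v] cancel[of B u v] cancel'[of A u v] cancel'[of B u v]
    by cases blast+
qed

text \<open>Extend a basis of \<open>P\<close> and an outside vector \<open>w\<close> to a basis of
  the whole space, then discard \<open>w\<close>. Codimension one is recorded by the fact that any
  \<open>t\<close> outside \<open>H\<close> can replace \<open>w\<close>.\<close>

lemma hyperplane_containing:
  assumes "subspace P" "P \<noteq> UNIV"
  obtains H where "subspace H" "P \<subseteq> H" "H \<noteq> UNIV"
    "\<forall>t v. t \<notin> H \<longrightarrow> (\<exists>c. v - c *s t \<in> H)"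
proof -
  obtain w where w: "w \<notin> P"
    using assms by auto
  obtain B where B: "B \<subseteq> P" "independent B" "P \<subseteq> span B"
    by (rule maximal_independent_subset)
  have spB: "span B = P"
    using B(1,3) assms(1) by (rule span_subspace)
  have "w \<notin> span B"
    using w spB by simp
  then have "independent (insert w B)"
    using B(2) by (rule independent_insertI)
  then obtain C where C: "insert w B \<subseteq> C" "independent C" "UNIV \<subseteq> span C"
    by (rule maximal_independent_subset_extend[OF subset_UNIV])
  let ?H = "span (C - {w})"
  have wH: "w \<notin> ?H"
    using C(1,2) unfolding dependent_def by blast
  have dec: "\<exists>c. v - c *s w \<in> ?H" for v
    using C(1,3) span_breakdown[of w C v] by blast
  show thesis
  proof
    show "subspace ?H"
      by simp
    have "w \<notin> B"
      using w B by auto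
    then have "span B \<subseteq> ?H"
      using C(1) by (intro span_mono) auto
    then show "P \<subseteq> ?H"
      using spB by simp
    show "?H \<noteq> UNIV"
      using wH by auto
    show "\<forall>t v. t \<notin> ?H \<longrightarrow> (\<exists>c. v - c *s t \<in> ?H)"
    proof (intro allI impI)
      fix t v assume t: "t \<notin> ?H"
      obtain d where d: "t - d *s w \<in> ?H"
        using dec by blast
      obtain e where e: "v - e *s w \<in> ?H"
        using dec by blast
      have "d \<noteq> 0"
        using d t by auto
      have "(v - e *s w) - (e / d) *s (t - d *s w) \<in> ?H"
        using subspace_span e d by (rule subspace_diff_scale)
      then have "v - (e / d) *s t \<in> ?H"
        using \<open>d \<noteq> 0\<close> by (simp add: scale_right_diff_distrib)
      then show "\<exists>c. v - c *s t \<in> ?H"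
        by blast
    qed
  qed
qed

text \<open>Let \<open>v\<close> avoid all subspaces except \<open>H j\<close>, which contains it,
  and let \<open>u\<close> lie outside \<open>H j\<close>. The line u + a v misses
  \<open>H j\<close> and meets every other subspace at most once, and there are fewer of those than
  scalars.\<close>

lemma finite_family_not_covering:
  fixes H :: "'i \<Rightarrow> 'b set"
  assumes "finite I" "card I \<le> card (UNIV :: 'a set)"
    and "\<And>i. i \<in> I \<Longrightarrow> subspace (H i) \<and> H i \<noteq> UNIV"
  shows "\<exists>v. \<forall>i\<in>I. v \<notin> H i"
  using assms
proof (induction I rule: finite_induct)
  case (insert j I)
  then obtain v where v: "\<forall>i\<in>I. v \<notin> H i"
    by auto
  show ?case
  proof (cases "v \<in> H j")
    case True
    obtain u where u: "u \<notin> H j"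
      using insert.prems by blast
    have "\<exists>a. \<forall>i\<in>I. u + a *s v \<notin> H i"
    proof (rule pigeonhole_avoid)
      show "card I < card (UNIV :: 'a set)"
        using insert by simp
      show "a = b" if "i \<in> I" "u + a *s v \<in> H i" "u + b *s v \<in> H i" for i a b
        using line_meets_complement_uniquely insert.prems that v by blast
    qed (use insert in simp)
    then obtain a where a: "\<forall>i\<in>I. u + a *s v \<notin> H i"
      by blast
    have sub: "subspace (H j)"
      using insert.prems by simp
    have "u + a *s v \<notin> H j"
    proof
      assume "u + a *s v \<in> H j"
      then have "(u + a *s v) - a *s v \<in> H j"
        using True by (intro subspace_diff_scale[OF sub])
      then show False
        using u by simp
    qed
    then show ?thesis
      using a by blast
  qed (use v in auto)
qed simp

end

section \<open>Alternating bilinear maps and dimension modulo a subspace\<close>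

locale alternating_bilinear = vector_space scale
  for scale :: "'a::field \<Rightarrow> 'b::ab_group_add \<Rightarrow> 'b" (infixr "*s" 75) +
  fixes br :: "'b \<Rightarrow> 'b \<Rightarrow> 'b"
  assumes add_left: "br (x + y) z = br x z + br y z"
    and add_right: "br x (y + z) = br x y + br x z"
    and scale_left: "br (c *s x) y = c *s br x y"
    and scale_right: "\<And>c x y. br x (c *s y) = c *s br x y"
    and self: "br x x = 0"
begin

lemma anticomm: "br x y = - br y x"
proof -
  have "br x y + br y x = (br x x + br y x) + (br x y + br y y)"
    by (simp add: self add.commute)
  also have "\<dots> = 0"
    unfolding add_left[symmetric] add_right[symmetric] by (rule self)
  finally show ?thesis
    by (simp add: eq_neg_iff_add_eq_0)
qed

lemma zero_left [simp]: "br 0 y = 0"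
  using scale_left[of 0 0 y] by simp

lemma zero_right [simp]: "br x 0 = 0"
  using scale_right[of x 0 0] by simp

lemma minus_left: "br (- x) y = - br x y"
  using add_left[of x "- x" y] by (simp add: eq_neg_iff_add_eq_0 add.commute)

lemma minus_right: "br x (- y) = - br x y"
  using add_right[of x y "- y"] by (simp add: eq_neg_iff_add_eq_0 add.commute)

lemma diff_left: "br (x - y) z = br x z - br y z"
  using add_left[of x "- y" z] by (simp add: minus_left)

lemma diff_right: "br x (y - z) = br x y - br x z"
  using add_right[of x y "- z"] by (simp add: minus_right)

text \<open>A dimension bound in the quotient by \<open>span N\<close>, expressed without forming
  quotients: factoring out [t, V] simply enlarges \<open>N\<close>.\<close>

definition spanned_over :: "'b set \<Rightarrow> nat \<Rightarrow> 'b set \<Rightarrow> bool" where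
  "spanned_over N d A \<longleftrightarrow> (\<exists>S. finite S \<and> card S \<le> d \<and> A \<subseteq> span (N \<union> S))"

lemma spanned_overI: "finite S \<Longrightarrow> card S \<le> d \<Longrightarrow> A \<subseteq> span (N \<union> S) \<Longrightarrow> spanned_over N d A"
  unfolding spanned_over_def by blast

lemma spanned_over_mono:
  assumes "spanned_over N d A" "d \<le> e" "B \<subseteq> A"
  shows "spanned_over N e B"
  using assms unfolding spanned_over_def by (meson order_trans)

lemma spanned_over_trivial:
  assumes "A \<subseteq> span N"
  shows "spanned_over N d A"
  using assms by (intro spanned_overI[of "{}"]) auto

lemma spanned_over_0: "spanned_over N 0 A \<Longrightarrow> A \<subseteq> span N"
  unfolding spanned_over_def by auto

lemma spanned_over_trans:
  assumes "spanned_over N d A" "spanned_over (N \<union> A) e B"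
  shows "spanned_over N (d + e) B"
proof -
  obtain S T where S: "finite S" "card S \<le> d" "A \<subseteq> span (N \<union> S)"
    and T: "finite T" "card T \<le> e" "B \<subseteq> span (N \<union> A \<union> T)"
    using assms unfolding spanned_over_def by auto
  have "A \<subseteq> span (N \<union> (S \<union> T))"
    using S(3) span_mono[of "N \<union> S" "N \<union> (S \<union> T)"] by auto
  then have "N \<union> A \<union> T \<subseteq> span (N \<union> (S \<union> T))"
    by (auto intro: span_base)
  then have "span (N \<union> A \<union> T) \<subseteq> span (N \<union> (S \<union> T))"
    by (simp add: span_minimal)
  moreover have "card (S \<union> T) \<le> d + e"
    using card_Un_le[of S T] S(2) T(2) by linarith
  ultimately show ?thesis
    using S(1) T(1,3) by (intro spanned_overI[of "S \<union> T"]) auto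
qed

text \<open>Steinitz exchange modulo \<open>N\<close>: discard elements of \<open>S\<close> until
  \<open>z\<close> leaves the span; the element whose removal causes this can be traded for
  \<open>z\<close>.\<close>

lemma exchange_over:
  assumes "finite S" "z \<in> span (N \<union> S)" "z \<notin> span N"
  shows "\<exists>s\<in>S. s \<in> span (insert z (N \<union> (S - {s})))"
  using assms
proof (induction S rule: finite_induct)
  case (insert a S)
  show ?case
  proof (cases "z \<in> span (N \<union> S)")
    case True
    then obtain s where s: "s \<in> S" "s \<in> span (insert z (N \<union> (S - {s})))"
      using insert by auto
    have "insert z (N \<union> (S - {s})) \<subseteq> insert z (N \<union> (insert a S - {s}))"
      by auto
    then show ?thesis
      using s span_mono by blast
  next
    case False
    then have "a \<in> span (insert z (N \<union> S))"
      using insert.prems in_span_insert[of z a "N \<union> S"] by simp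
    moreover have "insert a S - {a} = S"
      using insert.hyps by auto
    ultimately show ?thesis
      by auto
  qed
qed simp

text \<open>As \<open>z\<close> is nonzero modulo \<open>N\<close> but vanishes modulo
  \<open>N'\<close>, exchange allows one generator to be dropped. The same \<open>z\<close> forces
  \<open>d\<close> to be positive, so \<open>d - 1\<close> is not truncated.\<close>

lemma spanned_over_drop:
  assumes "spanned_over N d A" "z \<in> A" "z \<in> span N'" "z \<notin> span N" "N \<subseteq> N'"
  shows "spanned_over N' (d - 1) A"
proof -
  obtain S where S: "finite S" "card S \<le> d" "A \<subseteq> span (N \<union> S)"
    using assms unfolding spanned_over_def by auto
  then obtain s where s: "s \<in> S" "s \<in> span (insert z (N \<union> (S - {s})))"
    using exchange_over[of S z N] assms by auto
  let ?T = "N' \<union> (S - {s})"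
  have "insert z (N \<union> (S - {s})) \<subseteq> span ?T"
    using assms(3,5) span_mono[of N' ?T] by (auto intro: span_base)
  then have "s \<in> span ?T"
    using s(2) span_minimal[OF _ subspace_span] by blast
  then have "N \<union> S \<subseteq> span ?T"
    using assms(5) by (auto intro: span_base)
  then have "A \<subseteq> span ?T"
    using S(3) span_minimal[OF _ subspace_span] by blast
  moreover have "card (S - {s}) \<le> d - 1"
    using S s by simp
  ultimately show ?thesis
    using S(1) by (intro spanned_overI[of "S - {s}"]) auto
qed

lemma spanned_over_shift:
  assumes "spanned_over N d (f ` A)" "\<And>v. v \<in> A \<Longrightarrow> g v - f v \<in> span N"
  shows "spanned_over N d (g ` A)"
proof -
  obtain S where S: "finite S" "card S \<le> d" "f ` A \<subseteq> span (N \<union> S)"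
    using assms unfolding spanned_over_def by auto
  have "g v \<in> span (N \<union> S)" if "v \<in> A" for v
  proof -
    have "(g v - f v) + f v \<in> span (N \<union> S)"
      using assms(2)[OF that] S(3) that span_mono[of N "N \<union> S"] by (intro span_add) auto
    then show ?thesis
      by simp
  qed
  then show ?thesis
    using S by (intro spanned_overI[of S]) auto
qed

section \<open>Pivots and bounds for the span of all brackets\<close>

lemma swap_in_subspace: "subspace N \<Longrightarrow> br x y \<in> N \<longleftrightarrow> br y x \<in> N"
  using anticomm subspace_neg by metis

lemma subspace_centralizer_mod:
  assumes "subspace J"
  shows "subspace {x \<in> J. \<forall>y\<in>A. br y x \<in> span N}"
  using assms
  by (auto simp: subspace_def add_right scale_right span_add span_scale span_zero)

abbreviation brackets :: "'b set \<Rightarrow> 'b set" where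
  "brackets J \<equiv> {br x y | x y. x \<in> J \<and> y \<in> J}"

text \<open>Modulo [t, A] the maps [x, -] and [x + a t, -] agree. The image of the latter contains
  [x + a t, t] = -[t, x], which is nonzero modulo \<open>N\<close> and is killed by factoring out
  [t, A].\<close>

lemma drop_noncommuting:
  assumes "spanned_over N d (br (x + a *s t) ` A)" "t \<in> A" "x \<in> A" "br t x \<notin> span N"
  shows "spanned_over (N \<union> br t ` A) (d - 1) (br x ` A)"
proof (rule spanned_over_shift)
  let ?y = "x + a *s t" and ?N = "N \<union> br t ` A"
  have *: "br ?y v - br x v \<in> span ?N" if "v \<in> A" for v
    using that by (simp add: add_left scale_left span_base span_scale)
  have "br ?y t = - br t x"
    using anticomm[of x t] by (simp add: add_left scale_left self)
  then have "- br t x \<in> br ?y ` A"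
    using assms(2) by force
  moreover have "- br t x \<in> span ?N"
    using assms(3) by (intro span_neg span_base) auto
  moreover have "- br t x \<notin> span N"
    using assms(4) span_neg[of "- br t x" N] by auto
  ultimately show "spanned_over ?N (d - 1) (br ?y ` A)"
    using spanned_over_drop[OF assms(1)] by blast
  show "br x v - br ?y v \<in> span ?N" if "v \<in> A" for v
    using span_neg[OF *[OF that]] by simp
qed

text \<open>A pivot \<open>t\<close> outside \<open>L\<close> that is not central in
  \<open>J\<close> costs \<open>m\<close>. Afterwards its centralizer in \<open>J\<close> takes over
  the role of \<open>L\<close>, and the breadth bound is one smaller.\<close>

lemma brackets_bound:
  assumes J: "subspace J" and "subspace L" "\<not> J \<subseteq> L"
    and "\<And>x. x \<in> J - L \<Longrightarrow> spanned_over N m (br x ` J)"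
  shows "spanned_over N (tri (Suc m)) (brackets J)"
  using assms(2-)
proof (induction m arbitrary: N L)
  case (0 N L)
  obtain t where t: "t \<in> J" "t \<notin> L"
    using 0 by blast
  have *: "br x v \<in> span N" if "x \<in> J - L" "v \<in> J" for x v
    using 0(3)[OF that(1)] spanned_over_0 that(2) by blast
  have "br x v \<in> span N" if "x \<in> J" "v \<in> J" for x v
  proof (cases "x \<in> L")
    \<comment> \<open>An element of \<open>L\<close> is the difference of \<open>x + t\<close> and
      \<open>t\<close>, both outside \<open>L\<close>.\<close>
    case True
    then have "x + t \<in> J - L"
      using t that J 0(1) subspace_add subspace_diff[of L "x + t" x] by auto
    then have "br (x + t) v - br t v \<in> span N"
      using * t that by (intro span_diff) auto
    then show ?thesis
      by (simp add: add_left)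
  qed (use * that in auto)
  then show ?case
    by (intro spanned_over_trivial) auto
next
  case (Suc m N L)
  show ?case
  proof (cases "\<exists>t\<in>J - L. \<exists>v\<in>J. br t v \<notin> span N")
    case True
    then obtain t v where t: "t \<in> J" "t \<notin> L" and v: "v \<in> J" "br t v \<notin> span N"
      by blast
    let ?N = "N \<union> br t ` J" and ?L = "{x \<in> J. \<forall>y\<in>{t}. br y x \<in> span N}"
    have "spanned_over ?N (tri (Suc m)) (brackets J)"
    proof (rule Suc.IH)
      show "subspace ?L"
        using J by (rule subspace_centralizer_mod)
      show "\<not> J \<subseteq> ?L"
        using v by auto
      fix x assume x: "x \<in> J - ?L"
      then obtain a where a: "x + a *s t \<in> J - L"
        using line_leaves_subspace[OF J Suc.prems(1)] t by blast
      show "spanned_over ?N m (br x ` J)"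
        using drop_noncommuting[OF Suc.prems(3)[OF a]] t x by simp
    qed
    then have "spanned_over N (Suc m + tri (Suc m)) (brackets J)"
      using spanned_over_trans Suc.prems(3) t by blast
    then show ?thesis
      by (simp add: algebra_simps)
  next
    \<comment> \<open>Without a pivot, all of \<open>J - L\<close> is central in \<open>J\<close>
      modulo \<open>N\<close>, so the smaller breadth bound holds already.\<close>
    case False
    then have "spanned_over N 0 (br x ` J)" if "x \<in> J - L" for x
      using that by (intro spanned_over_trivial) auto
    then have "spanned_over N m (br x ` J)" if "x \<in> J - L" for x
      using that spanned_over_mono by blast
    then have "spanned_over N (tri (Suc m)) (brackets J)"
      using Suc.IH Suc.prems by blast
    then show ?thesis
      by (rule spanned_over_mono) auto
  qed
qed

lemma brackets_split:
  assumes J: "subspace J" and V: "\<And>v. \<exists>c. v - c *s s \<in> J" and M: "subspace M"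
    and JJ: "\<And>x y. x \<in> J \<Longrightarrow> y \<in> J \<Longrightarrow> br x y \<in> M"
    and sJ: "\<And>x. x \<in> J \<Longrightarrow> br s x \<in> M"
  shows "brackets UNIV \<subseteq> M"
proof -
  have "br x y \<in> M" for x y
  proof -
    obtain c d where c: "x - c *s s \<in> J" and d: "y - d *s s \<in> J"
      using V by blast
    let ?x = "x - c *s s" and ?y = "y - d *s s"
    have "br x y = br (?x + c *s s) (?y + d *s s)"
      by simp
    also have "\<dots> = br ?x ?y + d *s br ?x s + c *s br s ?y"
      by (simp only: add_left add_right scale_left scale_right self) simp
    also have "\<dots> \<in> M"
      using JJ[OF c d] sJ[OF c] sJ[OF d] swap_in_subspace[OF M, of s ?x]
      by (intro subspace_add subspace_scale M) blast+
    finally show ?thesis .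
  qed
  then show ?thesis
    by auto
qed

text \<open>Adding \<open>k\<close> for [s, V] to the bound for [J, J] would give tri m + m + k. To
  save \<open>m\<close>, each pivot is chosen not to commute with \<open>s\<close>, so that it
  lowers \<open>k\<close> as well as \<open>m\<close>. If no such pivot exists, either
  \<open>s\<close> centralizes \<open>J\<close> and [J, J] alone costs tri m + m, or
  \<open>J\<close> is abelian and only [s, V] remains.\<close>

lemma brackets_bound_extended:
  assumes J: "subspace J" and V: "\<And>v. \<exists>c. v - c *s s \<in> J"
    and "subspace L" "\<not> J \<subseteq> L"
    and "\<And>x. x \<in> J - L \<Longrightarrow> spanned_over N m (range (br x))"
    and "spanned_over N k (range (br s))" "m \<le> k"
  shows "spanned_over N (tri m + k) (brackets UNIV)"
  using assms(3-)
proof (induction m arbitrary: N L k)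
  case (0 N L k)
  obtain S where S: "finite S" "card S \<le> k" "range (br s) \<subseteq> span (N \<union> S)"
    using 0(4) unfolding spanned_over_def by blast
  \<comment> \<open>Since \<open>tri (Suc 0)\<close> is 0, this makes \<open>J\<close> abelian
    modulo \<open>N\<close>.\<close>
  have "spanned_over N (tri (Suc 0)) (brackets J)"
    using J 0(1,2)
  proof (rule brackets_bound)
    show "spanned_over N 0 (br x ` J)" if "x \<in> J - L" for x
      by (rule spanned_over_mono[OF 0(3)[OF that]]) auto
  qed
  then have "brackets J \<subseteq> span N"
    using spanned_over_0 by simp
  then have "brackets J \<subseteq> span (N \<union> S)"
    using span_mono[of N "N \<union> S"] by auto
  then have "brackets UNIV \<subseteq> span (N \<union> S)"
    using S(3) by (intro brackets_split[OF J V]) auto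
  then show ?case
    using S by (intro spanned_overI[of S]) auto
next
  case (Suc m N L k)
  let ?P = "{x \<in> J. \<forall>y\<in>{s}. br y x \<in> span N}"
  consider (central) "J \<subseteq> ?P" | (abelian) "brackets J \<subseteq> span N"
    | (pivot) "\<exists>t\<in>J - L. br s t \<notin> span N \<and> (\<exists>v\<in>J. br t v \<notin> span N)"
  proof (cases "J \<subseteq> ?P \<or> brackets J \<subseteq> span N")
    case False
    then obtain u v where uv: "u \<in> J" "v \<in> J" "br u v \<notin> span N"
      by blast
    \<comment> \<open>\<open>e\<close> is itself a pivot unless it is central in \<open>J\<close>;
      in that case it serves to translate \<open>u\<close>, \<open>v\<close> and
      \<open>u + v\<close>.\<close>
    obtain e where e: "e \<in> J" "e \<notin> L" "e \<notin> ?P"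
      using subspace_not_union_two[OF J Suc.prems(1) subspace_centralizer_mod[OF J]
          Suc.prems(2), of "{s}" N] False by blast
    show thesis
    proof (cases "\<exists>v\<in>J. br e v \<notin> span N")
      case True
      moreover have "br s e \<notin> span N"
        using e by simp
      ultimately show thesis
        using e(1,2) by (intro that(3)) blast
    next
      case ecomm: False
      have "\<exists>x\<in>{u, v, u + v, e + u, e + v, e + (u + v)}. x \<notin> L \<and> x \<notin> ?P"
        using Suc.prems(1) subspace_centralizer_mod[OF J] e(2,3) by (rule subspace_pair_avoid)
      then obtain x where x: "x \<in> {u, v, u + v, e + u, e + v, e + (u + v)}" "x \<notin> L" "x \<notin> ?P"
        by (elim bexE conjE)
      have "u + v \<in> J" "e + u \<in> J" "e + v \<in> J" "e + (u + v) \<in> J"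
        using e(1) uv(1,2) J by (simp_all add: subspace_add)
      then have xJ: "x \<in> J"
        using x(1) uv(1,2) by blast
      have ev: "br e w \<in> span N" if "w \<in> J" for w
        using ecomm that by blast
      have vu: "br v u \<notin> span N"
        using uv(3) swap_in_subspace[OF subspace_span] by blast
      \<comment> \<open>Adding the central \<open>e\<close> does not affect brackets with
        \<open>J\<close> modulo \<open>N\<close>, so each of the six candidates fails to commute
        with \<open>u\<close> or with \<open>v\<close>.\<close>
      have shift: "br (e + y) w \<in> span N \<longleftrightarrow> br y w \<in> span N" if "w \<in> J" for y w
        unfolding add_left using ev[OF that] by (rule span_add_eq)
      have "br (u + v) v = br u v"
        by (simp add: add_left self)
      then have "br x u \<notin> span N \<or> br x v \<notin> span N"
        using x(1) uv(3) vu shift[OF uv(1)] shift[OF uv(2)] by (elim insertE) simp_all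
      then have "\<exists>w\<in>J. br x w \<notin> span N"
        using uv(1,2) by blast
      moreover have "br s x \<notin> span N"
        using x(3) xJ by simp
      ultimately show thesis
        using x(2) xJ by (intro that(3)) blast
    qed
  qed (use that in blast)
  then show ?case
  proof cases
    case central
    have "spanned_over N (tri (Suc (Suc m))) (brackets J)"
      using J Suc.prems(1,2)
    proof (rule brackets_bound)
      show "spanned_over N (Suc m) (br x ` J)" if "x \<in> J - L" for x
        by (rule spanned_over_mono[OF Suc.prems(3)[OF that]]) auto
    qed
    then obtain S where S: "finite S" "card S \<le> tri (Suc (Suc m))" "brackets J \<subseteq> span (N \<union> S)"
      unfolding spanned_over_def by blast
    have "brackets UNIV \<subseteq> span (N \<union> S)"
      using S(3) central span_mono[of N "N \<union> S"] by (intro brackets_split[OF J V]) auto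
    then show ?thesis
      using S Suc.prems(5) by (intro spanned_overI[of S]) auto
  next
    case abelian
    obtain S where S: "finite S" "card S \<le> k" "range (br s) \<subseteq> span (N \<union> S)"
      using Suc.prems(4) unfolding spanned_over_def by blast
    have "brackets UNIV \<subseteq> span (N \<union> S)"
      using S(3) abelian span_mono[of N "N \<union> S"] by (intro brackets_split[OF J V]) auto
    then show ?thesis
      using S by (intro spanned_overI[of S]) auto
  next
    case pivot
    then obtain t v where t: "t \<in> J" "t \<notin> L" "br s t \<notin> span N" and v: "v \<in> J" "br t v \<notin> span N"
      by blast
    let ?N = "N \<union> range (br t)" and ?L = "{x \<in> J. \<forall>y\<in>{t}. br y x \<in> span N}"
    have "spanned_over ?N (tri m + (k - 1)) (brackets UNIV)"
    proof (rule Suc.IH)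
      show "subspace ?L"
        using J by (rule subspace_centralizer_mod)
      show "\<not> J \<subseteq> ?L"
        using v by auto
      show "m \<le> k - 1"
        using Suc.prems(5) by simp
      have "br t s \<notin> span N"
        using t(3) swap_in_subspace[OF subspace_span] by blast
      \<comment> \<open>With shift \<open>a = 0\<close>: \<open>s\<close> itself does not commute
        with \<open>t\<close>, so its own breadth drops.\<close>
      then show "spanned_over ?N (k - 1) (range (br s))"
        using drop_noncommuting[of N k s 0 t UNIV] Suc.prems(4) by simp
      fix x assume x: "x \<in> J - ?L"
      then obtain a where a: "x + a *s t \<in> J - L"
        using line_leaves_subspace[OF J Suc.prems(1)] t by blast
      show "spanned_over ?N m (range (br x))"
        using drop_noncommuting[OF Suc.prems(3)[OF a]] t x by simp
    qed
    then have "spanned_over N (Suc m + (tri m + (k - 1))) (brackets UNIV)"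
      using spanned_over_trans Suc.prems(3) t by blast
    then show ?thesis
      using Suc.prems(5) by (simp add: algebra_simps)
  qed
qed

text \<open>Indexing by the scalars gives exactly q hyperplanes and two distinct indices 0 and 1.
  The span \<open>J\<close> of L and an element outside all hyperplanes has codimension at most one.
  A suitable first pivot in \<open>J\<close> leads to \<open>brackets_bound_extended\<close>;
  failing that, \<open>s\<close> centralizes \<open>J\<close> or \<open>J\<close> is
  abelian.\<close>

lemma brackets_bound_cover:
  fixes H :: "'a \<Rightarrow> 'b set"
  assumes fin: "finite (UNIV :: 'a set)"
    and H: "\<And>i. subspace (H i)" "\<And>i. H i \<noteq> UNIV"
    and hyp: "\<And>i t v. t \<notin> H i \<Longrightarrow> \<exists>c. v - c *s t \<in> H i"
    and small: "\<And>x. (\<forall>i. x \<notin> H i) \<Longrightarrow> spanned_over {} m (range (br x))"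
    and gen: "\<And>J. subspace J \<Longrightarrow> H 0 \<inter> H 1 \<subseteq> J \<Longrightarrow> J \<noteq> UNIV \<Longrightarrow>
                \<exists>s. s \<notin> J \<and> spanned_over {} k (range (br s))"
    and "m \<le> k"
  shows "spanned_over {} (tri m + k) (brackets UNIV)"
proof -
  define U where "U = {x. \<forall>i. x \<notin> H i}"
  define L where "L = H 0 \<inter> H 1"
  have L: "subspace L"
    unfolding L_def using H subspace_inter by blast
  have few: "card (UNIV - {1 :: 'a}) < card (UNIV :: 'a set)"
    using fin by (intro psubset_card_mono) auto
  obtain t\<^sub>0 where t\<^sub>0: "t\<^sub>0 \<in> U"
    using finite_family_not_covering[of UNIV H] fin H unfolding U_def by auto
  define J where "J = {x. \<exists>c. x - c *s t\<^sub>0 \<in> L}"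
  have "span L = L"
    using L by simp
  then have J_eq: "J = span (insert t\<^sub>0 L)"
    unfolding J_def span_insert by (simp only:)
  have J: "subspace J"
    unfolding J_eq by simp
  have LJ: "L \<subseteq> J"
    unfolding J_eq by (auto intro: span_base)
  have J_decomp: "\<exists>c. x - c *s t \<in> L" if "x \<in> J" "t \<in> U \<inter> J" for x t
  proof -
    obtain c d where cd: "x - c *s t\<^sub>0 \<in> L" "t - d *s t\<^sub>0 \<in> L"
      using \<open>x \<in> J\<close> \<open>t \<in> U \<inter> J\<close> unfolding J_def by auto
    have "d \<noteq> 0"
      using cd(2) that(2) unfolding U_def L_def by auto
    have "(x - c *s t\<^sub>0) - (c / d) *s (t - d *s t\<^sub>0) \<in> L"
      using L cd by (rule subspace_diff_scale)
    then have "x - (c / d) *s t \<in> L"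
      using \<open>d \<noteq> 0\<close> by (simp add: scale_right_diff_distrib)
    then show ?thesis
      by blast
  qed
  have reach: "\<exists>a. x + a *s t \<in> U \<inter> J" if x: "x \<in> J" and t: "t \<in> U \<inter> J" for x t
  proof -
    obtain c where c: "x - c *s t \<in> L"
      using J_decomp x t by blast
    have tU: "t \<notin> H i" for i
      using t unfolding U_def by blast
    have H01: "x + a *s t \<in> H 0" if "x + a *s t \<in> H 1" for a
    proof -
      have "x + (- c) *s t \<in> H 0" "x + (- c) *s t \<in> H 1"
        using c unfolding L_def by auto
      then show ?thesis
        using line_meets_complement_uniquely[OF H(1) tU that] by blast
    qed
    have "\<exists>a. \<forall>i\<in>UNIV - {1}. x + a *s t \<notin> H i"
      by (rule pigeonhole_avoid)
        (use fin few line_meets_complement_uniquely[OF H(1) tU] in auto)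
    then obtain a where a: "\<And>i. i \<noteq> 1 \<Longrightarrow> x + a *s t \<notin> H i"
      by auto
    have "x + a *s t \<notin> H i" for i
      using a[of i] a[of 0] H01 by (cases "i = 1") auto
    then have "x + a *s t \<in> U"
      unfolding U_def by blast
    moreover have "x + a *s t \<in> J"
      using x t J by (intro subspace_add subspace_scale) auto
    ultimately show ?thesis
      by blast
  qed
  have perturb: "\<exists>a. a \<noteq> 0 \<and> t + a *s l \<in> U \<inter> J" if l: "l \<in> L" and t: "t \<in> U \<inter> J" for l t
  proof -
    have tU: "t \<notin> H i" for i
      using t unfolding U_def by blast
    have never: "t + a *s l \<notin> H i" if "l \<in> H i" for a i
    proof
      assume "t + a *s l \<in> H i"
      then have "t + a *s l - a *s l \<in> H i"
        using that by (intro subspace_diff_scale[OF H(1)])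
      then show False
        using tU by simp
    qed
    \<comment> \<open>The line never meets \<open>H 0\<close> or \<open>H 1\<close>, as both contain
      \<open>l\<close>. So index 1 is left out, and the slot of index 0 is spent on excluding
      \<open>a = 0\<close>.\<close>
    have "\<exists>a. \<forall>i\<in>UNIV - {1}. \<not> (if i = 0 then a = 0 else t + a *s l \<in> H i)"
      by (rule pigeonhole_avoid)
        (use fin few line_through_outside_uniquely[OF H(1) tU] in \<open>auto split: if_splits\<close>)
    then obtain a where a: "\<And>i. i \<noteq> 1 \<Longrightarrow> \<not> (if i = 0 then a = 0 else t + a *s l \<in> H i)"
      by auto
    have "t + a *s l \<notin> H i" for i
      using a[of i] never[of i a] l unfolding L_def by (cases "i = 0 \<or> i = 1") auto
    moreover have "t + a *s l \<in> J"
      using l t J LJ by (intro subspace_add subspace_scale) auto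
    ultimately show ?thesis
      using a[of 0] unfolding U_def by auto
  qed
  have t\<^sub>0J: "t\<^sub>0 \<in> U \<inter> J"
    unfolding J_eq using t\<^sub>0 by (auto intro: span_base)

  obtain s where s: "spanned_over {} k (range (br s))" and V: "\<And>v. \<exists>c. v - c *s s \<in> J"
  proof (cases "J = UNIV")
    \<comment> \<open>If \<open>J\<close> is the whole space, \<open>s = 0\<close> serves as the
      complementary vector.\<close>
    case True
    have "spanned_over {} k (range (br 0))"
      by (intro spanned_over_trivial) auto
    then show thesis
      using that[of 0] True by auto
  next
    case False
    then obtain s where s: "s \<notin> J" "spanned_over {} k (range (br s))"
      using gen[OF J] LJ unfolding L_def by blast
    have t\<^sub>0U: "t\<^sub>0 \<notin> H i" for i
      using t\<^sub>0 unfolding U_def by blast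
    \<comment> \<open>The second coefficient \<open>d\<close> detects distance from
      \<open>J\<close>: it is nonzero for \<open>s\<close>, so subtracting (d'/d) s from
      \<open>v\<close> cancels the coefficient of \<open>v\<close> and lands in
      \<open>J\<close>.\<close>
    have dec: "\<exists>c d. v - c *s t\<^sub>0 \<in> H 0 \<and> v - c *s t\<^sub>0 - d *s t\<^sub>0 \<in> H 1" for v
      using hyp[OF t\<^sub>0U] by meson
    have "\<exists>c. v - c *s s \<in> J" for v
    proof -
      obtain c d where s': "s - c *s t\<^sub>0 \<in> H 0" "s - c *s t\<^sub>0 - d *s t\<^sub>0 \<in> H 1"
        using dec by blast
      obtain c' d' where v': "v - c' *s t\<^sub>0 \<in> H 0" "v - c' *s t\<^sub>0 - d' *s t\<^sub>0 \<in> H 1"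
        using dec by blast
      have "d \<noteq> 0"
        using s' s(1) unfolding J_def L_def by auto
      let ?e = "d' / d"
      have "(v - c' *s t\<^sub>0) - ?e *s (s - c *s t\<^sub>0) \<in> H 0"
        using H(1) v'(1) s'(1) by (rule subspace_diff_scale)
      moreover have "(v - c' *s t\<^sub>0 - d' *s t\<^sub>0) - ?e *s (s - c *s t\<^sub>0 - d *s t\<^sub>0) \<in> H 1"
        using H(1) v'(2) s'(2) by (rule subspace_diff_scale)
      ultimately have "(v - ?e *s s) - (c' - ?e * c) *s t\<^sub>0 \<in> L"
        using \<open>d \<noteq> 0\<close> unfolding L_def
        by (simp add: scale_right_diff_distrib scale_left_diff_distrib algebra_simps)
      then show ?thesis
        unfolding J_def by blast
    qed
    then show thesis
      using that s by blast
  qed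

  have drop: "spanned_over (range (br t)) (m - 1) (range (br x))"
    if t: "t \<in> U \<inter> J" and x: "x \<in> J" "br t x \<noteq> 0" for t x
  proof -
    obtain a where "x + a *s t \<in> U"
      using reach t x by blast
    then have "spanned_over {} m (range (br (x + a *s t)))"
      using small unfolding U_def by blast
    then show ?thesis
      using drop_noncommuting[of "{}" m x a t UNIV] x by simp
  qed
  \<comment> \<open>This makes the later subtractions \<open>m - 1\<close> exact.\<close>
  have pos: "m \<ge> 1" if "t \<in> U" "br t x \<noteq> 0" for t x
  proof (rule ccontr)
    assume "\<not> m \<ge> 1"
    then have "m = 0"
      by simp
    moreover have "spanned_over {} m (range (br t))"
      using small that(1) unfolding U_def by blast
    ultimately have "range (br t) \<subseteq> {0}"
      using spanned_over_0[of "{}" "range (br t)"] by simp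
    then show False
      using that(2) by blast
  qed
  have CJ: "subspace {x \<in> J. br t x = 0}" for t
    using subspace_centralizer_mod[OF J, of "{t}" "{}"] by simp
  have comb: "spanned_over {} (m + e) B" if "t \<in> U" "spanned_over (range (br t)) e B" for t e B
    using spanned_over_trans[of "{}" m "range (br t)" e B] that small unfolding U_def by simp

  \<comment> \<open>[t, V] costs \<open>m\<close>; [t, l] nonzero makes the centralizer of
    \<open>t\<close> proper in \<open>J\<close>, and [s, t] nonzero lowers \<open>k\<close>. The sum
    m + tri(m-1) + (k-1) is exactly tri m + k.\<close>
  have pivot: ?thesis
    if t: "t \<in> U \<inter> J" and l: "l \<in> L" "br t l \<noteq> 0" and st: "br s t \<noteq> 0" for t l
  proof -
    have m: "m \<ge> 1"
      using pos t l by blast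
    have "spanned_over (range (br t)) (tri (m - 1) + (k - 1)) (brackets UNIV)"
    proof (rule brackets_bound_extended[OF J V CJ])
      show "\<not> J \<subseteq> {x \<in> J. br t x = 0}"
        using l LJ by auto
      show "spanned_over (range (br t)) (m - 1) (range (br x))"
        if "x \<in> J - {x \<in> J. br t x = 0}" for x
        using drop[OF t] that by blast
      have "br t s \<noteq> 0"
        using st anticomm[of s t] by auto
      then show "spanned_over (range (br t)) (k - 1) (range (br s))"
        using drop_noncommuting[of "{}" k s 0 t UNIV] s by simp
      show "m - 1 \<le> k - 1"
        using \<open>m \<le> k\<close> by simp
    qed
    then have "spanned_over {} (m + (tri (m - 1) + (k - 1))) (brackets UNIV)"
      using comb t by blast
    moreover have "m + (tri (m - 1) + (k - 1)) = tri m + k"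
      using m \<open>m \<le> k\<close> by (cases m) auto
    ultimately show ?thesis
      by simp
  qed

  have abelian: ?thesis if JJ: "\<And>x y. x \<in> J \<Longrightarrow> y \<in> J \<Longrightarrow> br x y = 0"
  proof -
    obtain S where S: "finite S" "card S \<le> k" "range (br s) \<subseteq> span S"
      using s unfolding spanned_over_def by auto
    have "brackets UNIV \<subseteq> span S"
      by (rule brackets_split[OF J V subspace_span]) (use S(3) JJ span_zero in auto)
    then show ?thesis
      using S by (intro spanned_overI[of S]) auto
  qed

  show ?thesis
  proof (cases "\<exists>t\<in>U \<inter> J. br s t \<noteq> 0")
    case False
    \<comment> \<open>Both x + a t and t lie in \<open>U \<inter> J\<close> for t =
      \<open>t\<^sub>0\<close>, and \<open>x\<close> is a combination of them.\<close>
    have central: "br s x = 0" if "x \<in> J" for x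
    proof -
      obtain a where "x + a *s t\<^sub>0 \<in> U \<inter> J"
        using reach t\<^sub>0J \<open>x \<in> J\<close> by blast
      then have "br s (x + a *s t\<^sub>0) = 0" "br s t\<^sub>0 = 0"
        using False t\<^sub>0J by auto
      then show ?thesis
        by (simp add: add_right scale_right)
    qed
    show ?thesis
    proof (cases "\<exists>t\<in>U \<inter> J. \<exists>v\<in>J. br t v \<noteq> 0")
      case True
      then obtain t v where t: "t \<in> U \<inter> J" and v: "v \<in> J" "br t v \<noteq> 0"
        by blast
      \<comment> \<open>As \<open>s\<close> centralizes \<open>J\<close>, the budget
        \<open>k\<close> is free to pay the cost \<open>m\<close> of the pivot.\<close>
      have "spanned_over (range (br t)) (tri (Suc (m - 1))) (brackets J)"
      proof (rule brackets_bound[OF J CJ])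
        show "\<not> J \<subseteq> {x \<in> J. br t x = 0}"
          using v by auto
        show "spanned_over (range (br t)) (m - 1) (br x ` J)"
          if "x \<in> J - {x \<in> J. br t x = 0}" for x
          by (rule spanned_over_mono[OF drop[OF t]]) (use that in auto)
      qed
      moreover have "Suc (m - 1) = m"
        using pos[of t v] t v(2) by simp
      ultimately have "spanned_over {} (m + tri m) (brackets J)"
        using comb[of t "tri m" "brackets J"] t by (simp only: IntD1)
      then obtain S where S: "finite S" "card S \<le> m + tri m" "brackets J \<subseteq> span S"
        unfolding spanned_over_def by auto
      have "brackets UNIV \<subseteq> span S"
        by (rule brackets_split[OF J V subspace_span]) (use S(3) central span_zero in auto)
      then show ?thesis
        using S \<open>m \<le> k\<close> by (intro spanned_overI[of S]) auto
    next
      case all: False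
      have "br x y = 0" if "x \<in> J" "y \<in> J" for x y
      proof -
        obtain a where "x + a *s t\<^sub>0 \<in> U \<inter> J"
          using reach t\<^sub>0J \<open>x \<in> J\<close> by blast
        then have "br (x + a *s t\<^sub>0) y = 0" "br t\<^sub>0 y = 0"
          using all t\<^sub>0J \<open>y \<in> J\<close> by blast+
        then show ?thesis
          by (simp add: add_left scale_left)
      qed
      then show ?thesis
        by (rule abelian)
    qed
  next
    case True
    then obtain t where t: "t \<in> U \<inter> J" "br s t \<noteq> 0"
      by blast
    show ?thesis
    proof (cases "\<exists>l\<in>L. br t l \<noteq> 0")
      case True
      then show ?thesis
        using pivot t by blast
    next
      case tL: False
      show ?thesis
      \<comment> \<open>Now \<open>t\<close> centralizes \<open>L\<close>. If \<open>L\<close> is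
        not abelian, adding a suitable element of \<open>L\<close> to \<open>t\<close> yields a
        pivot; if it is, then \<open>J\<close>, spanned by \<open>L\<close> and \<open>t\<close>, is
        abelian too.\<close>
      proof (cases "\<exists>l\<in>L. \<exists>l'\<in>L. br l l' \<noteq> 0")
        case True
        then obtain l\<^sub>1 l\<^sub>2 where l: "l\<^sub>1 \<in> L" "l\<^sub>2 \<in> L" "br l\<^sub>1 l\<^sub>2 \<noteq> 0"
          by blast
        then have l21: "br l\<^sub>2 l\<^sub>1 \<noteq> 0"
          using anticomm[of l\<^sub>1 l\<^sub>2] by auto
        obtain a\<^sub>1 a\<^sub>2 where a1: "a\<^sub>1 \<noteq> 0" "t + a\<^sub>1 *s l\<^sub>1 \<in> U \<inter> J"
          and a2: "a\<^sub>2 \<noteq> 0" "t + a\<^sub>2 *s l\<^sub>2 \<in> U \<inter> J"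
          using perturb l t by meson
        \<comment> \<open>If \<open>s\<close> commutes with both \<open>t + a\<^sub>1 l\<^sub>1\<close> and \<open>t + a\<^sub>2 l\<^sub>2\<close>, then it commutes with \<open>l\<close>,
            so that perturbing \<open>t\<close> by \<open>l\<close> leaves \<open>[s, t]\<close> unchanged.\<close>
        define l where "l = a\<^sub>1 *s l\<^sub>1 - a\<^sub>2 *s l\<^sub>2"
        have lL: "l \<in> L"
          unfolding l_def using l L by (intro subspace_diff subspace_scale)
        obtain a where a: "a \<noteq> 0" "t + a *s l \<in> U \<inter> J"
          using perturb lL t by meson
        have ne: "br (t + a\<^sub>1 *s l\<^sub>1) l\<^sub>2 \<noteq> 0" "br (t + a\<^sub>2 *s l\<^sub>2) l\<^sub>1 \<noteq> 0" "br (t + a *s l) l\<^sub>2 \<noteq> 0"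
          using tL l l21 a a1 a2 by (auto simp: l_def add_left scale_left diff_left self)
        show ?thesis
        proof (cases "br s (t + a\<^sub>1 *s l\<^sub>1) = 0 \<and> br s (t + a\<^sub>2 *s l\<^sub>2) = 0")
          case True
          then have "br s (t + a\<^sub>1 *s l\<^sub>1) - br s (t + a\<^sub>2 *s l\<^sub>2) = 0"
            by simp
          then have "br s l = 0"
            by (simp add: l_def add_right diff_right)
          then have "br s (t + a *s l) \<noteq> 0"
            using t by (simp add: add_right scale_right)
          then show ?thesis
            using pivot[OF a(2) l(2)] ne by blast
        next
          case False
          then show ?thesis
            using pivot[OF a1(2) l(2)] pivot[OF a2(2) l(1)] ne by blast
        qed
      next
        case LL: False
        have "br x y = 0" if xy: "x \<in> J" "y \<in> J" for x y
        proof -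
          obtain c d where cd: "x - c *s t \<in> L" "y - d *s t \<in> L"
            using J_decomp[OF xy(1) t(1)] J_decomp[OF xy(2) t(1)] by blast
          then have "br (x - c *s t) (y - d *s t) = 0"
            "br t (x - c *s t) = 0" "br t (y - d *s t) = 0"
            using LL tL by blast+
          moreover from this have "br x t = 0"
            using anticomm[of x t] by (simp add: diff_right scale_right self)
          ultimately show ?thesis
            by (simp add: diff_left diff_right scale_left scale_right self)
        qed
        then show ?thesis
          by (rule abelian)
      qed
    qed
  qed
qed

section \<open>Breadth, the dimension of the derived algebra, and nilpotency\<close>

lemma breadth_spanned:
  assumes "breadth scale br x = enat d"
  shows "spanned_over {} d (range (br x))"
proof -
  let ?P = "\<lambda>d S. finite S \<and> span (centralizer br x \<union> S) = UNIV \<and> card S = d"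
  have ex: "\<exists>S. finite S \<and> span (centralizer br x \<union> S) = UNIV"
    using assms unfolding breadth_def ecodim_def by (auto split: if_splits)
  then have "d = (LEAST d. \<exists>S. ?P d S)"
    using assms unfolding breadth_def ecodim_def by simp
  moreover have "\<exists>d S. ?P d S"
    using ex by blast
  ultimately have "\<exists>S. ?P d S"
    using LeastI_ex[of "\<lambda>d. \<exists>S. ?P d S"] by simp
  then obtain S where S: "finite S" "span (centralizer br x \<union> S) = UNIV" "card S = d"
    by blast
  \<comment> \<open>The \<open>d\<close> vectors that complete the centralizer to a spanning set
    have images spanning [x, V].\<close>
  have "subspace {v. br x v \<in> span (br x ` S)}"
    by (auto simp: subspace_def add_right scale_right span_add span_scale span_zero)
  moreover have "centralizer br x \<union> S \<subseteq> {v. br x v \<in> span (br x ` S)}"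
    by (auto simp: centralizer_def span_zero intro: span_base)
  ultimately have "range (br x) \<subseteq> span (br x ` S)"
    using span_minimal[of "centralizer br x \<union> S" "{v. br x v \<in> span (br x ` S)}"] S(2) by auto
  then show ?thesis
    using S card_image_le[of S "br x"] by (intro spanned_overI[of "br x ` S"]) auto
qed

text \<open>\<open>edim\<close> asks for generators inside the derived algebra, while
  \<open>S\<close> may lie outside it. A basis chosen inside is independent in
  \<open>span S\<close>, hence no larger than \<open>S\<close>.\<close>

lemma edim_derived_le:
  assumes "spanned_over {} D (brackets UNIV)"
  shows "\<exists>d. edim scale (derived scale br) = enat d \<and> d \<le> D"
proof -
  obtain S where S: "finite S" "card S \<le> D" "brackets UNIV \<subseteq> span S"
    using assms unfolding spanned_over_def by auto
  let ?U = "derived scale br"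
  have U: "?U = span (brackets UNIV)"
    unfolding derived_def by simp
  then have sub: "subspace ?U" and US: "?U \<subseteq> span S"
    using span_minimal[OF S(3)] by simp_all
  obtain B where B: "B \<subseteq> ?U" "independent B" "?U \<subseteq> span B"
    by (rule maximal_independent_subset)
  have spB: "span B = ?U"
    using B(1,3) sub by (rule span_subspace)
  have "B \<subseteq> span S"
    using B(1) US by (rule subset_trans)
  then have finB: "finite B" "card B \<le> card S"
    using independent_span_bound[OF S(1) B(2)] by auto
  let ?P = "\<lambda>d. \<exists>S. finite S \<and> S \<subseteq> ?U \<and> span S = ?U \<and> card S = d"
  have "?P (card B)"
    using B(1) spB finB(1) by blast
  then have "(LEAST d. ?P d) \<le> card B"
    by (rule Least_le)
  moreover have "edim scale ?U = enat (LEAST d. ?P d)"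
    unfolding edim_def using B(1) spB finB(1) by auto
  ultimately show ?thesis
    using finB(2) S(2) by auto
qed

text \<open>Induction along the lower central series C_i shows that H + C_i is everything: then
  every bracket lies in H + C_(i+1), which thus contains \<open>H\<close> and the derived algebra.
  At the end C_i is zero.\<close>

lemma nilpotent_subalgebra_supplement:
  assumes "nilpotent_lie scale br" "lie_subalgebra scale br H"
    and "span (H \<union> derived scale br) = UNIV"
  shows "H = UNIV"
proof -
  have H: "subspace H" "\<And>x y. x \<in> H \<Longrightarrow> y \<in> H \<Longrightarrow> br x y \<in> H"
    using assms(2) unfolding lie_subalgebra_def by auto
  have "span (H \<union> lower_central scale br i) = UNIV" for i
  proof (induction i)
    case (Suc i)
    let ?C = "lower_central scale br i" and ?C' = "lower_central scale br (Suc i)"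
    let ?M = "span (H \<union> ?C')"
    have M: "subspace ?M"
      by simp
    have C': "br x y \<in> ?M" if "y \<in> ?C" for x y
      using that by (auto intro!: span_base)
    have decomp: "\<exists>h c. x = h + c \<and> h \<in> H \<and> c \<in> span ?C" for x
    proof -
      have "x \<in> span (H \<union> ?C)"
        using Suc.IH by simp
      then obtain h c where "x = h + c" "h \<in> span H" "c \<in> span ?C"
        unfolding span_Un by blast
      moreover have "span H = H"
        using H(1) by simp
      ultimately show ?thesis
        by blast
    qed
    have spC: "br x y \<in> ?M" if "y \<in> span ?C" for x y
    proof -
      have "subspace {y. br x y \<in> ?M}"
        by (auto simp: subspace_def add_right scale_right span_add span_scale span_zero)
      moreover have "?C \<subseteq> {y. br x y \<in> ?M}"
        using C' by blast
      ultimately have "span ?C \<subseteq> {y. br x y \<in> ?M}"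
        by (rule span_minimal[rotated])
      then show ?thesis
        using that by blast
    qed
    have "br x y \<in> ?M" for x y
    proof -
      obtain h c h' c' where xy: "x = h + c" "y = h' + c'"
        and mem: "h \<in> H" "h' \<in> H" "c \<in> span ?C" "c' \<in> span ?C"
        using decomp[of x] decomp[of y] by blast
      have "br h h' \<in> ?M"
        using H(2) mem by (auto intro: span_base)
      moreover have "br c h' \<in> ?M"
        using spC[OF mem(3), of h'] swap_in_subspace[OF M] by blast
      ultimately show ?thesis
        unfolding xy add_left add_right using spC[OF mem(4)] by (intro span_add)
    qed
    then have "derived scale br \<subseteq> ?M"
      unfolding derived_def by (intro span_minimal) auto
    then have "H \<union> derived scale br \<subseteq> ?M"
      by (auto intro: span_base)
    then have "span (H \<union> derived scale br) \<subseteq> ?M"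
      by (rule span_minimal) simp
    then show ?case
      using assms(3) by blast
  qed (simp add: span_UNIV)
  moreover obtain i where "lower_central scale br i = {0}"
    using assms(1) unfolding nilpotent_lie_def by blast
  ultimately have "span (H \<union> {0}) = UNIV"
    by metis
  moreover have "span (H \<union> {0}) \<subseteq> H"
    using H(1) subspace_0 by (intro span_minimal) auto
  ultimately show ?thesis
    by blast
qed

end

section \<open>Reduction to hyperplanes containing the derived algebra\<close>

theorem theorem5p1:
  fixes scale :: "'k::{field,finite} \<Rightarrow> 'g::ab_group_add \<Rightarrow> 'g"
    and br :: "'g \<Rightarrow> 'g \<Rightarrow> 'g"
    and n k :: int
  assumes "lie_algebra scale br"
    and "nilpotent_lie scale br"
    and "n \<le> k + 1"
    and "\<exists>H :: 'k \<Rightarrow> 'g set.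
           (\<forall>i. lie_subalgebra scale br (H i) \<and> H i \<noteq> UNIV) \<and>
           {x. \<not> (\<exists>d. breadth scale br x = enat d \<and> int d < n)} \<subseteq> (\<Union>i. H i)"
    and "lie_generated scale br {x. \<exists>d. breadth scale br x = enat d \<and> int d \<le> k} = UNIV"
  shows "\<exists>d. edim scale (derived scale br) = enat d \<and>
           int d \<le> ((n - 1) * (n - 2)) div 2 + k"
proof -
  interpret alternating_bilinear scale br
    using assms(1) unfolding lie_algebra_def alternating_bilinear_def alternating_bilinear_axioms_def
    by (elim conjE) (intro conjI)
  obtain H :: "'k \<Rightarrow> 'g set" where H': "\<forall>i. lie_subalgebra scale br (H i) \<and> H i \<noteq> UNIV"
    and cover': "{x. \<not> (\<exists>d. breadth scale br x = enat d \<and> int d < n)} \<subseteq> (\<Union>i. H i)"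
    using assms(4) by (elim exE conjE)
  have H: "lie_subalgebra scale br (H i)" "H i \<noteq> UNIV" for i
    using H' by simp_all
  have cover: "\<exists>d. breadth scale br x = enat d \<and> int d < n" if "\<forall>i. x \<notin> H i" for x
    using subsetD[OF cover', of x] that by auto
  have "\<exists>K. subspace K \<and> H i \<union> derived scale br \<subseteq> K \<and> K \<noteq> UNIV \<and>
      (\<forall>t v. t \<notin> K \<longrightarrow> (\<exists>c. v - scale c t \<in> K))" for i
  proof -
    have "span (H i \<union> derived scale br) \<noteq> UNIV"
      using nilpotent_subalgebra_supplement[OF assms(2) H(1)] H(2) by blast
    then obtain K where "subspace K" "span (H i \<union> derived scale br) \<subseteq> K" "K \<noteq> UNIV"
      "\<forall>t v. t \<notin> K \<longrightarrow> (\<exists>c. v - scale c t \<in> K)"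
      by (rule hyperplane_containing[OF subspace_span])
    moreover have "H i \<union> derived scale br \<subseteq> span (H i \<union> derived scale br)"
      by (rule span_superset)
    ultimately show ?thesis
      by (intro exI[of _ K]) blast
  qed
  then obtain K where K: "\<And>i. subspace (K i)" "\<And>i. H i \<union> derived scale br \<subseteq> K i" "\<And>i. K i \<noteq> UNIV"
    and hyp: "\<And>i t v. t \<notin> K i \<Longrightarrow> \<exists>c. v - scale c t \<in> K i"
    by metis
  have small: "\<exists>d. breadth scale br x = enat d \<and> int d < n" if "\<forall>i. x \<notin> K i" for x
    using cover K(2) that by blast
  \<comment> \<open>A vector outside all hyperplanes has a natural number below \<open>n\<close> as
    its breadth. Hence \<open>n\<close> is positive, and the conversions by \<open>nat\<close> below
    lose nothing.\<close>
  obtain x where "\<forall>i. x \<notin> K i"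
    using finite_family_not_covering[of UNIV K] K(1,3) by auto
  then have n: "n \<ge> 1"
    using small by fastforce
  then have k: "k \<ge> 0"
    using assms(3) by simp
  have "spanned_over {} (tri (nat (n - 1)) + nat k) (brackets UNIV)"
  proof (rule brackets_bound_cover[of K])
    show "finite (UNIV :: 'k set)" "nat (n - 1) \<le> nat k"
      using assms(3) by auto
    show "subspace (K i)" "K i \<noteq> UNIV" for i
      using K by auto
    show "\<exists>c. v - scale c t \<in> K i" if "t \<notin> K i" for i t v
      using hyp that by blast
    show "spanned_over {} (nat (n - 1)) (range (br x))" if x: "\<forall>i. x \<notin> K i" for x
    proof -
      obtain d where d: "breadth scale br x = enat d" "int d < n"
        using small x by blast
      show ?thesis
        by (rule spanned_over_mono[OF breadth_spanned[OF d(1)]]) (use d(2) in auto)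
    qed
    show "\<exists>s. s \<notin> J \<and> spanned_over {} (nat k) (range (br s))"
      if J: "subspace J" "K 0 \<inter> K 1 \<subseteq> J" "J \<noteq> UNIV" for J
    proof -
      \<comment> \<open>Every \<open>K i\<close> contains the derived algebra, hence so does
        \<open>J\<close>. It is therefore a proper subalgebra and cannot contain the generating
        set.\<close>
      have "br x y \<in> derived scale br" for x y
        unfolding derived_def by (auto intro: span_base)
      then have "lie_subalgebra scale br J"
        using J(1,2) K(2) unfolding lie_subalgebra_def by blast
      then have "\<not> {x. \<exists>d. breadth scale br x = enat d \<and> int d \<le> k} \<subseteq> J"
        using assms(5) J(3) unfolding lie_generated_def by blast
      then obtain s d where s: "s \<notin> J" "breadth scale br s = enat d" "int d \<le> k"
        by blast
      have "spanned_over {} (nat k) (range (br s))"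
        by (rule spanned_over_mono[OF breadth_spanned[OF s(2)]]) (use s(3) in auto)
      then show ?thesis
        using s(1) by blast
    qed
  qed
  then obtain d where "edim scale (derived scale br) = enat d" "d \<le> tri (nat (n - 1)) + nat k"
    using edim_derived_le by blast
  moreover have "int (tri (nat (n - 1)) + nat k) = ((n - 1) * (n - 2)) div 2 + k"
    using n k by (simp add: tri_eq)
  ultimately show ?thesis
    by (metis of_nat_le_iff)
qed

end
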